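(* Let $B=10$. The smallest Gaussian happy numbers of heights $0$, $1$, $2$ are, respectively, $1$; $-1$; and $i,-i$. For heights $h=3,4,5,6$, the smallest Gaussian happy numbers of height $h$ are exactly $z,-z,\pm\overline{z},\pm iz,\pm i\overline{z}$, where $z=12+12i$ for $h=3$, $z=4+4i$ for $h=4$, $z=7$ for $h=5$, and $z=5+19i$ for $h=6$.
   Context: Every nonzero Gaussian integer $a+bi$ is written uniquely as $a+bi=\sum_{j=0}^n (a_j+b_ji)10^j$ with $a_j,b_j\in\mathbb{Z}$, $a_n,b_n$ not both $0$, and for each $j$: $|a_j|\le 9$, $|b_j|\le 9$, $\operatorname{sgn}(a)a_j\ge 0$, $\operatorname{sgn}(b)b_j\ge 0$. The Gaussian happy function $S_{10}:\mathbb{Z}[i]\to\mathbb{Z}[i]$ is defined by $S_{10}(0)=0$ and $S_{10}(a+bi)=\sum_{j=0}^n (a_j+b_ji)^2$. A Gaussian integer $z$ is Gaussian happy if $S_{10}^k(z)=1$ for some $k\ge1$. The height of a Gaussian happy number $z$ is the least $k\in\mathbb{Z}_{\ge0}$ with $S_{10}^k(z)=1$ ($S_{10}^0$ is the identity). "Smallest" means of minimal complex absolute value among Gaussian happy numbers of the given height. *)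

theory Defs
  imports Complex_Main
begin

definition gaussian_ints :: "complex set" where
  "gaussian_ints = {z. Re z \<in> \<int> \<and> Im z \<in> \<int>}"

definition gaussian_expansion :: "complex \<Rightarrow> nat \<Rightarrow> (nat \<Rightarrow> int) \<Rightarrow> (nat \<Rightarrow> int) \<Rightarrow> bool" where
  "gaussian_expansion z n a b \<longleftrightarrow>
     z = (\<Sum>j\<le>n. (of_int (a j) + of_int (b j) * \<i>) * 10 ^ j) \<and>
     \<not> (a n = 0 \<and> b n = 0) \<and>
     (\<forall>j\<le>n. \<bar>a j\<bar> \<le> 9 \<and> \<bar>b j\<bar> \<le> 9 \<and>
        sgn (Re z) * real_of_int (a j) \<ge> 0 \<and> sgn (Im z) * real_of_int (b j) \<ge> 0)"

text \<open>
  Every nonzero Gaussian integer has exactly one expansion (see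
  \<open>gaussian_expansion_exists\<close> and \<open>gaussian_expansion_unique\<close> below), so the
  definite description is well defined there. The value outside
  \<^const>\<open>gaussian_ints\<close> is irrelevant.
\<close>
definition S10 :: "complex \<Rightarrow> complex" where
  "S10 z = (if z = 0 then 0
     else (THE s. \<exists>n a b. gaussian_expansion z n a b \<and>
                     s = (\<Sum>j\<le>n. (of_int (a j) + of_int (b j) * \<i>)\<^sup>2)))"

definition gaussian_happy :: "complex \<Rightarrow> bool" where
  "gaussian_happy z \<longleftrightarrow> z \<in> gaussian_ints \<and> (\<exists>k\<ge>1. (S10 ^^ k) z = 1)"

definition happy_height :: "complex \<Rightarrow> nat" where
  "happy_height z = (LEAST k. (S10 ^^ k) z = 1)"

definition smallest_happy :: "nat \<Rightarrow> complex set" where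
  "smallest_happy h =
     {z. gaussian_happy z \<and> happy_height z = h \<and>
         (\<forall>w. gaussian_happy w \<and> happy_height w = h \<longrightarrow> cmod z \<le> cmod w)}"

definition symmetric_images :: "complex \<Rightarrow> complex set" where
  "symmetric_images z =
     {z, - z, cnj z, - cnj z, \<i> * z, - (\<i> * z), \<i> * cnj z, - (\<i> * cnj z)}"


lemma digit_sum_Suc:
  "(\<Sum>j\<le>Suc n. c j * 10 ^ j) = c 0 + 10 * (\<Sum>j\<le>n. c (Suc j) * 10 ^ j)" for c :: "nat \<Rightarrow> int"
  by (simp add: sum.atMost_Suc_shift sum_distrib_left mult.left_commute del: sum.atMost_Suc)

lemma digits_zero:
  fixes c :: "nat \<Rightarrow> int"
  assumes "(\<Sum>j\<le>n. c j * 10 ^ j) = 0" "\<And>j. j \<le> n \<Longrightarrow> \<bar>c j\<bar> \<le> 9" "j \<le> n"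
  shows "c j = 0"
  using assms
proof (induction n arbitrary: c j)
  case (Suc n)
  have e: "c 0 + 10 * (\<Sum>j\<le>n. c (Suc j) * 10 ^ j) = 0"
    using Suc.prems(1) unfolding digit_sum_Suc .
  moreover have "\<bar>c 0\<bar> \<le> 9" using Suc.prems(2) by blast
  ultimately have "c 0 = 0" "(\<Sum>j\<le>n. c (Suc j) * 10 ^ j) = 0" by presburger+
  then show ?case
    using Suc.IH[of "\<lambda>j. c (Suc j)" "j - 1"] Suc.prems(2,3) by (cases j) auto
qed simp

lemma digits_equal:
  fixes c d :: "nat \<Rightarrow> int"
  assumes "(\<Sum>j\<le>n. c j * 10 ^ j) = (\<Sum>j\<le>n. d j * 10 ^ j)"
    and "\<And>j. j \<le> n \<Longrightarrow> \<bar>c j - d j\<bar> \<le> 9" and "j \<le> n"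
  shows "c j = d j"
  using digits_zero[of "\<lambda>j. c j - d j" n j] assms
  by (simp add: left_diff_distrib sum_subtractf)

lemma digits_unique:
  fixes c d :: "nat \<Rightarrow> int" and x :: real
  assumes c: "x = real_of_int (\<Sum>j\<le>n. c j * 10 ^ j)"
    and d: "x = real_of_int (\<Sum>j\<le>n. d j * 10 ^ j)"
    and cb: "\<And>j. j \<le> n \<Longrightarrow> \<bar>c j\<bar> \<le> 9 \<and> sgn x * real_of_int (c j) \<ge> 0"
    and db: "\<And>j. j \<le> n \<Longrightarrow> \<bar>d j\<bar> \<le> 9 \<and> sgn x * real_of_int (d j) \<ge> 0"
    and j: "j \<le> n"
  shows "c j = d j"
proof (cases "x = 0")
  case True
  have "c j = 0" by (rule digits_zero[of c n]) (use c True cb j in \<open>auto simp del: of_int_sum\<close>)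
  moreover have "d j = 0"
    by (rule digits_zero[of d n]) (use d True db j in \<open>auto simp del: of_int_sum\<close>)
  ultimately show ?thesis by simp
next
  case False
  have "\<bar>c i - d i\<bar> \<le> 9" if "i \<le> n" for i
    using cb[OF that] db[OF that] False by (cases "x > 0") (auto simp: sgn_if)
  moreover have "(\<Sum>j\<le>n. c j * 10 ^ j) = (\<Sum>j\<le>n. d j * 10 ^ j)"
    using c d by linarith
  ultimately show ?thesis using digits_equal j by blast
qed

lemma digit_sum_pad:
  fixes c :: "nat \<Rightarrow> int"
  assumes "n \<le> N"
  shows "(\<Sum>j\<le>n. c j * 10 ^ j) = (\<Sum>j\<le>N. (if j \<le> n then c j else 0) * 10 ^ j)"
  using assms by (intro sum.mono_neutral_cong_left) auto

lemma gaussian_expansion_Re_Im: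
  assumes "gaussian_expansion z n a b"
  shows "Re z = real_of_int (\<Sum>j\<le>n. a j * 10 ^ j)" "Im z = real_of_int (\<Sum>j\<le>n. b j * 10 ^ j)"
proof -
  have p: "(10::complex) ^ j = complex_of_real (10 ^ j)" for j by simp
  have z: "z = (\<Sum>j\<le>n. (of_int (a j) + of_int (b j) * \<i>) * 10 ^ j)"
    using assms unfolding gaussian_expansion_def by blast
  show "Re z = real_of_int (\<Sum>j\<le>n. a j * 10 ^ j)"
    unfolding z p by (simp del: of_real_power)
  show "Im z = real_of_int (\<Sum>j\<le>n. b j * 10 ^ j)"
    unfolding z p by (simp del: of_real_power)
qed

theorem gaussian_expansion_unique:
  assumes 1: "gaussian_expansion z n a b" and 2: "gaussian_expansion z m c d"
  shows "n = m" and "\<forall>j\<le>n. a j = c j \<and> b j = d j"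
proof -
  define N where "N = max n m"
  define ext where "ext k f j = (if j \<le> k then f j else 0)" for k and f :: "nat \<Rightarrow> int" and j :: nat
  have N: "n \<le> N" "m \<le> N" by (auto simp: N_def)
  note r = gaussian_expansion_Re_Im[OF 1] gaussian_expansion_Re_Im[OF 2]
  note r' = r[unfolded digit_sum_pad[OF N(1)] digit_sum_pad[OF N(2)], folded ext_def]
  have b1: "\<forall>j\<le>n. \<bar>a j\<bar> \<le> 9 \<and> \<bar>b j\<bar> \<le> 9 \<and>
      sgn (Re z) * real_of_int (a j) \<ge> 0 \<and> sgn (Im z) * real_of_int (b j) \<ge> 0"
    and t1: "\<not> (a n = 0 \<and> b n = 0)"
    using 1 unfolding gaussian_expansion_def by blast+
  have b2: "\<forall>j\<le>m. \<bar>c j\<bar> \<le> 9 \<and> \<bar>d j\<bar> \<le> 9 \<and>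
      sgn (Re z) * real_of_int (c j) \<ge> 0 \<and> sgn (Im z) * real_of_int (d j) \<ge> 0"
    and t2: "\<not> (c m = 0 \<and> d m = 0)"
    using 2 unfolding gaussian_expansion_def by blast+
  have A: "ext n a j = ext m c j" if "j \<le> N" for j
    by (rule digits_unique[OF r'(1) r'(3) _ _ that]) (use b1 b2 in \<open>auto simp: ext_def\<close>)
  have B: "ext n b j = ext m d j" if "j \<le> N" for j
    by (rule digits_unique[OF r'(2) r'(4) _ _ that]) (use b1 b2 in \<open>auto simp: ext_def\<close>)
  show "n = m"
  proof (rule ccontr)
    assume "n \<noteq> m"
    then consider "n < m" | "m < n" by linarith
    then show False
    proof cases
      case 1 then show False using A[of m] B[of m] N t2 by (simp add: ext_def)
    next
      case 2 then show False using A[of n] B[of n] N t1 by (simp add: ext_def)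
    qed
  qed
  then show "\<forall>j\<le>n. a j = c j \<and> b j = d j"
    using A B N unfolding ext_def by (metis order_trans)
qed

lemma digit_sum_mod:
  "(\<Sum>j\<le>n. (x div 10 ^ j mod 10) * 10 ^ j) = x mod 10 ^ Suc n" for x :: int
proof (induction n)
  case (Suc n)
  have "x mod (10 ^ Suc n * 10) = 10 ^ Suc n * (x div 10 ^ Suc n mod 10) + x mod 10 ^ Suc n"
    by (rule zmod_zmult2_eq) simp
  with Suc show ?case by (simp add: mult.commute)
qed simp

theorem gaussian_expansion_exists:
  assumes "z \<in> gaussian_ints" "z \<noteq> 0"
  shows "\<exists>n a b. gaussian_expansion z n a b"
proof -
  obtain x y where xy: "Re z = real_of_int x" "Im z = real_of_int y"
    using assms(1) by (auto simp: gaussian_ints_def elim!: Ints_cases)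
  define P where "P k \<longleftrightarrow> \<bar>x\<bar> < 10 ^ Suc k \<and> \<bar>y\<bar> < 10 ^ Suc k" for k
  define dg where "dg u j = sgn u * (\<bar>u\<bar> div 10 ^ j mod 10)" for u :: int and j :: nat
  have "P (nat (max \<bar>x\<bar> \<bar>y\<bar>))"
  proof -
    have "int k < 10 ^ Suc k" for k :: nat
      by (induction k) auto
    from this[of "nat (max \<bar>x\<bar> \<bar>y\<bar>)"] show ?thesis unfolding P_def by linarith
  qed
  then have "\<exists>n. P n \<and> (\<forall>k<n. \<not> P k)" by (metis LeastI_ex not_less_Least)
  then obtain n where n: "P n" "\<forall>k<n. \<not> P k" by blast
  have s: "(\<Sum>j\<le>n. dg u j * 10 ^ j) = u" if "\<bar>u\<bar> < 10 ^ Suc n" for u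
  proof -
    have "(\<Sum>j\<le>n. dg u j * 10 ^ j) = sgn u * (\<Sum>j\<le>n. (\<bar>u\<bar> div 10 ^ j mod 10) * 10 ^ j)"
      by (simp add: dg_def sum_distrib_left mult.assoc)
    also have "\<dots> = sgn u * \<bar>u\<bar>" unfolding digit_sum_mod using that by simp
    finally show ?thesis by (simp add: sgn_mult_abs)
  qed
  have bd: "\<bar>dg u j\<bar> \<le> 9" for u j
  proof -
    have "\<bar>sgn u * q\<bar> \<le> 9" if "0 \<le> q" "q \<le> 9" for q :: int
      using that by (simp add: sgn_if)
    moreover have "0 \<le> \<bar>u\<bar> div 10 ^ j mod 10" "\<bar>u\<bar> div 10 ^ j mod 10 \<le> 9" by simp_all
    ultimately show ?thesis unfolding dg_def by blast
  qed
  have sg: "sgn (real_of_int u) * real_of_int (dg u j) \<ge> 0" for u j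
  proof -
    have "sgn (real_of_int u) * real_of_int (sgn u * q) \<ge> 0" if "0 \<le> q" for q :: int
      using that by (simp add: sgn_if)
    moreover have "0 \<le> \<bar>u\<bar> div 10 ^ j mod 10" by simp
    ultimately show ?thesis unfolding dg_def by blast
  qed
  have top: "\<not> (dg x n = 0 \<and> dg y n = 0)"
  proof
    assume h: "dg x n = 0 \<and> dg y n = 0"
    have l: "\<bar>u\<bar> < 10 ^ n" if "dg u n = 0" "\<bar>u\<bar> < 10 ^ Suc n" for u
    proof (cases "u = 0")
      case False
      let ?q = "\<bar>u\<bar> div 10 ^ n"
      have "\<bar>u\<bar> = ?q * 10 ^ n + \<bar>u\<bar> mod 10 ^ n" by (rule div_mult_mod_eq[symmetric])
      moreover have "0 \<le> \<bar>u\<bar> mod 10 ^ n" "\<bar>u\<bar> mod 10 ^ n < 10 ^ n" by simp_all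
      ultimately have "?q * 10 ^ n < 10 * 10 ^ n" using that(2) unfolding power_Suc by linarith
      then have "?q < 10" by simp
      moreover have "?q \<ge> 0" by (simp add: pos_imp_zdiv_nonneg_iff)
      moreover have "?q mod 10 = 0" using that(1) False by (simp add: dg_def sgn_if split: if_splits)
      ultimately have "?q = 0" by (metis mod_pos_pos_trivial)
      then show ?thesis
        using \<open>\<bar>u\<bar> = ?q * 10 ^ n + \<bar>u\<bar> mod 10 ^ n\<close> \<open>\<bar>u\<bar> mod 10 ^ n < 10 ^ n\<close>
        by (metis add_0 mult_zero_left)
    qed simp
    have "\<bar>x\<bar> < 10 ^ n" "\<bar>y\<bar> < 10 ^ n" using l h n(1) by (auto simp: P_def)
    then show False
    proof (cases n)
      case 0
      with \<open>\<bar>x\<bar> < 10 ^ n\<close> \<open>\<bar>y\<bar> < 10 ^ n\<close> have "x = 0" "y = 0" by auto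
      with xy assms(2) show False by (simp add: complex_eq_iff)
    next
      case (Suc k)
      with n(2) \<open>\<bar>x\<bar> < 10 ^ n\<close> \<open>\<bar>y\<bar> < 10 ^ n\<close> show False by (auto simp: P_def)
    qed
  qed
  have p: "(10::complex) ^ j = complex_of_real (10 ^ j)" for j by simp
  have "z = (\<Sum>j\<le>n. (of_int (dg x j) + of_int (dg y j) * \<i>) * 10 ^ j)"
  proof (rule complex_eqI)
    show "Re z = Re (\<Sum>j\<le>n. (of_int (dg x j) + of_int (dg y j) * \<i>) * 10 ^ j)"
      using arg_cong[OF s[of x], of real_of_int] n(1) unfolding p
      by (simp add: xy P_def del: of_real_power)
    show "Im z = Im (\<Sum>j\<le>n. (of_int (dg x j) + of_int (dg y j) * \<i>) * 10 ^ j)"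
      using arg_cong[OF s[of y], of real_of_int] n(1) unfolding p
      by (simp add: xy P_def del: of_real_power)
  qed
  with top bd sg have "gaussian_expansion z n (dg x) (dg y)"
    unfolding gaussian_expansion_def xy by blast
  then show ?thesis by blast
qed

lemma S10_eq:
  assumes "gaussian_expansion z n a b"
  shows "S10 z = (\<Sum>j\<le>n. (of_int (a j) + of_int (b j) * \<i>)\<^sup>2)"
proof -
  have "z \<noteq> 0"
  proof
    assume "z = 0"
    then have "(\<Sum>j\<le>n. a j * 10 ^ j) = 0" "(\<Sum>j\<le>n. b j * 10 ^ j) = 0"
      using gaussian_expansion_Re_Im[OF assms] by (metis of_int_eq_0_iff zero_complex.sel)+
    then have "a n = 0" "b n = 0"
      using digits_zero assms unfolding gaussian_expansion_def by blast+
    then show False using assms unfolding gaussian_expansion_def by blast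
  qed
  moreover have "(THE s. \<exists>n a b. gaussian_expansion z n a b \<and>
      s = (\<Sum>j\<le>n. (of_int (a j) + of_int (b j) * \<i>)\<^sup>2)) = (\<Sum>j\<le>n. (of_int (a j) + of_int (b j) * \<i>)\<^sup>2)"
  proof (rule the_equality)
    fix s assume "\<exists>n a b. gaussian_expansion z n a b \<and>
      s = (\<Sum>j\<le>n. (of_int (a j) + of_int (b j) * \<i>)\<^sup>2)"
    then obtain m c d where e: "gaussian_expansion z m c d"
      "s = (\<Sum>j\<le>m. (of_int (c j) + of_int (d j) * \<i>)\<^sup>2)" by blast
    from gaussian_expansion_unique[OF assms e(1)]
    show "s = (\<Sum>j\<le>n. (of_int (a j) + of_int (b j) * \<i>)\<^sup>2)"
      unfolding e(2) by (intro sum.cong) auto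
  qed (use assms in blast)
  ultimately show ?thesis by (simp add: S10_def)
qed

end

theory Submission
  imports Defs
begin

text \<open>
  In integer coordinates the happy function is given by dot products of decimal digit vectors:
  the real part of \<open>S10 (x + y\<i>)\<close> is \<open>\<langle>x, x\<rangle> - \<langle>y, y\<rangle>\<close> and its imaginary part is
  \<open>2 sgn x sgn y \<langle>x, y\<rangle>\<close>. Whether a Gaussian integer is happy of height exactly \<open>h\<close> depends on its
  first \<open>h\<close> iterates only, so each of the seven claims is a finite computation over the lattice
  points of a disc whose squared radius is at most \<open>5\<^sup>2 + 19\<^sup>2 = 386\<close>.
\<close>

section \<open>Executable dot products of decimal digit vectors\<close>

text \<open>Once either argument is exhausted, all further digit products vanish, so the recursion
  may stop there.\<close>

function digit_dot :: "int \<Rightarrow> int \<Rightarrow> int" where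
  "digit_dot m n =
     (if m \<le> 0 \<or> n \<le> 0 then 0 else (m mod 10) * (n mod 10) + digit_dot (m div 10) (n div 10))"
  by auto
termination by (relation "measure (\<lambda>(m, n). nat m)") auto

declare digit_dot.simps [simp del]

lemma digit_dot_eq_sum:
  assumes "0 \<le> m" "m < 10 ^ N" "0 \<le> n" "n < 10 ^ N"
  shows "digit_dot m n = (\<Sum>j<N. (m div 10 ^ j mod 10) * (n div 10 ^ j mod 10))"
  using assms
proof (induction N arbitrary: m n)
  case 0
  then show ?case by (subst digit_dot.simps) simp
next
  case (Suc N)
  show ?case
  proof (cases "m = 0 \<or> n = 0")
    case True
    then show ?thesis by (subst digit_dot.simps) auto
  next
    case False
    have "m div 10 < 10 ^ N" "n div 10 < 10 ^ N"
      using Suc.prems by (simp_all add: div_less_iff_less_mult mult.commute)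
    then have "digit_dot (m div 10) (n div 10) =
        (\<Sum>j<N. (m div 10 div 10 ^ j mod 10) * (n div 10 div 10 ^ j mod 10))"
      using Suc.prems by (intro Suc.IH) (simp_all add: pos_imp_zdiv_nonneg_iff)
    also have "\<dots> = (\<Sum>j<N. (m div 10 ^ Suc j mod 10) * (n div 10 ^ Suc j mod 10))"
      by (simp add: zdiv_zmult2_eq)
    finally show ?thesis
      using False Suc.prems
      by (subst digit_dot.simps) (simp add: sum.lessThan_Suc_shift del: sum.lessThan_Suc)
  qed
qed

text \<open>Leading zero positions contribute nothing to either sum. They are stripped until the top
  digit pair is nonzero, where \<open>S10_eq\<close> applies, or until \<open>z = 0\<close>. Both
  coordinates may thus be padded to one length.\<close>

lemma S10_eq_padded:
  assumes "z = (\<Sum>j\<le>N. (of_int (a j) + of_int (b j) * \<i>) * 10 ^ j)"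
    and "\<And>j. \<bar>a j\<bar> \<le> 9 \<and> \<bar>b j\<bar> \<le> 9 \<and>
        sgn (Re z) * real_of_int (a j) \<ge> 0 \<and> sgn (Im z) * real_of_int (b j) \<ge> 0"
  shows "S10 z = (\<Sum>j\<le>N. (of_int (a j) + of_int (b j) * \<i>)\<^sup>2)"
  using assms(1)
proof (induction N)
  case 0
  show ?case
  proof (cases "a 0 = 0 \<and> b 0 = 0")
    case True
    with 0 show ?thesis by (simp add: S10_def)
  next
    case False
    with 0 assms(2) have "gaussian_expansion z 0 a b" unfolding gaussian_expansion_def by blast
    then show ?thesis by (rule S10_eq)
  qed
next
  case (Suc N)
  show ?case
  proof (cases "a (Suc N) = 0 \<and> b (Suc N) = 0")
    case True
    with Suc show ?thesis by simp
  next
    case False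
    with Suc.prems assms(2) have "gaussian_expansion z (Suc N) a b"
      unfolding gaussian_expansion_def by blast
    then show ?thesis by (rule S10_eq)
  qed
qed

section \<open>The happy function in integer coordinates\<close>

definition of_pair :: "int \<times> int \<Rightarrow> complex" where
  "of_pair p = Complex (of_int (fst p)) (of_int (snd p))"

text \<open>All digits of a coordinate share its sign, which squares away in the real part and
  survives as a factor in the imaginary part.\<close>

definition happy_step :: "int \<times> int \<Rightarrow> int \<times> int" where
  "happy_step p = (case p of (x, y) \<Rightarrow>
     (digit_dot (abs x) (abs x) - digit_dot (abs y) (abs y),
      2 * sgn x * sgn y * digit_dot (abs x) (abs y)))"

lemma of_pair_inject [simp]: "of_pair p = of_pair q \<longleftrightarrow> p = q"
  by (auto simp: of_pair_def prod_eq_iff)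

lemma of_pair_one: "of_pair (1, 0) = 1"
  by (simp add: of_pair_def complex_eq_iff)

lemma range_of_pair: "range of_pair = gaussian_ints"
proof (intro set_eqI iffI)
  fix z assume "z \<in> gaussian_ints"
  then obtain x y where "Re z = of_int x" "Im z = of_int y"
    by (auto simp: gaussian_ints_def elim!: Ints_cases)
  then have "z = of_pair (x, y)" by (simp add: of_pair_def complex_eq_iff)
  then show "z \<in> range of_pair" by blast
qed (auto simp: of_pair_def gaussian_ints_def)

lemma int_less_power10: "\<bar>x\<bar> < 10 ^ nat \<bar>x\<bar>" for x :: int
proof -
  have "int (nat \<bar>x\<bar>) < int (10 ^ nat \<bar>x\<bar>)"
    unfolding of_nat_less_iff by (rule power_gt_expt) simp
  then show ?thesis by simp
qed

lemma S10_of_pair: "S10 (of_pair p) = of_pair (happy_step p)"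
proof -
  obtain x y where p: "p = (x, y)" by fastforce
  \<comment> \<open>A crude common bound: \<open>S10_eq_padded\<close> tolerates leading zeros, so
    the exact number of digits is never computed. The range \<open>j \<le> N\<close> has
    \<open>Suc N\<close> positions.\<close>
  define N where "N = nat (max \<bar>x\<bar> \<bar>y\<bar>)"
  define dg where "dg u j = sgn u * (\<bar>u\<bar> div 10 ^ j mod 10)" for u :: int and j :: nat
  have "\<bar>x\<bar> < 10 ^ nat \<bar>x\<bar>" "\<bar>y\<bar> < 10 ^ nat \<bar>y\<bar>" by (rule int_less_power10)+
  moreover have "(10::int) ^ nat \<bar>x\<bar> \<le> 10 ^ Suc N" "(10::int) ^ nat \<bar>y\<bar> \<le> 10 ^ Suc N"
    by (rule power_increasing; simp add: N_def)+
  ultimately have less: "\<bar>x\<bar> < 10 ^ Suc N" "\<bar>y\<bar> < 10 ^ Suc N" by linarith+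
  have dg_sum: "real_of_int u = (\<Sum>j\<le>N. real_of_int (dg u j) * 10 ^ j)" if "\<bar>u\<bar> < 10 ^ Suc N" for u
  proof -
    have "(\<Sum>j\<le>N. dg u j * 10 ^ j) = sgn u * (\<Sum>j\<le>N. (\<bar>u\<bar> div 10 ^ j mod 10) * 10 ^ j)"
      by (simp add: dg_def sum_distrib_left mult.assoc)
    also have "\<dots> = u" unfolding digit_sum_mod using that by (simp add: sgn_mult_abs)
    finally have "real_of_int (\<Sum>j\<le>N. dg u j * 10 ^ j) = real_of_int u" by simp
    then show ?thesis by simp
  qed
  have dg_bound: "\<bar>dg u j\<bar> \<le> 9 \<and> sgn (real_of_int u) * real_of_int (dg u j) \<ge> 0" for u j
  proof -
    have "\<bar>sgn u * q\<bar> \<le> 9 \<and> sgn (real_of_int u) * real_of_int (sgn u * q) \<ge> 0"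
      if "0 \<le> q" "q \<le> 9" for q :: int
      using that by (simp add: sgn_if)
    moreover have "0 \<le> \<bar>u\<bar> div 10 ^ j mod 10" "\<bar>u\<bar> div 10 ^ j mod 10 \<le> 9" by simp_all
    ultimately show ?thesis unfolding dg_def by blast
  qed
  have dot: "(\<Sum>j\<le>N. dg u j * dg v j) = sgn u * sgn v * digit_dot (abs u) (abs v)"
    if "\<bar>u\<bar> < 10 ^ Suc N" "\<bar>v\<bar> < 10 ^ Suc N" for u v
    using that
    by (simp add: digit_dot_eq_sum[of _ "Suc N"] dg_def sum_distrib_left lessThan_Suc_atMost
        algebra_simps del: power_Suc sum.lessThan_Suc)
  \<comment> \<open>The sign factor is 1 unless \<open>u = 0\<close>, where the dot product vanishes
    anyway.\<close>
  have self_dot: "sgn u * sgn u * digit_dot (abs u) (abs u) = digit_dot (abs u) (abs u)" for u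
    by (cases "u = 0") (simp_all add: digit_dot.simps[of 0] sgn_if)
  \<comment> \<open>As embedded reals, the powers let \<open>Re\<close> and \<open>Im\<close> pass
    through each summand.\<close>
  have ten: "(10::complex) ^ j = complex_of_real (10 ^ j)" for j by simp
  have "S10 (of_pair p) = (\<Sum>j\<le>N. (of_int (dg x j) + of_int (dg y j) * \<i>)\<^sup>2)"
  proof (rule S10_eq_padded)
    show "of_pair p = (\<Sum>j\<le>N. (of_int (dg x j) + of_int (dg y j) * \<i>) * 10 ^ j)"
      using dg_sum[OF less(1)] dg_sum[OF less(2)] unfolding ten
      by (simp add: complex_eq_iff p of_pair_def del: of_real_power)
  qed (use dg_bound in \<open>simp add: p of_pair_def\<close>)
  also have "\<dots> = of_pair ((\<Sum>j\<le>N. dg x j * dg x j) - (\<Sum>j\<le>N. dg y j * dg y j),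
      2 * (\<Sum>j\<le>N. dg x j * dg y j))"
    by (simp add: complex_eq_iff of_pair_def power2_eq_square sum_subtractf sum_distrib_left
        algebra_simps flip: sum.distrib)
  also have "\<dots> = of_pair (happy_step p)"
    unfolding dot[OF less(1) less(1)] dot[OF less(2) less(2)] dot[OF less] self_dot
    by (simp add: p happy_step_def mult.assoc)
  finally show ?thesis .
qed

section \<open>Heights decided by finitely many iterates\<close>

text \<open>
  Here and in \<open>smallest_in_box\<close>, conditionals replace the logical connectives because
  \<open>code_simp\<close> evaluates both arguments of a connective but only one branch of a conditional.
\<close>

primrec height_is :: "nat \<Rightarrow> int \<times> int \<Rightarrow> bool" where
  "height_is 0 p \<longleftrightarrow> p = (1, 0)"
| "height_is (Suc h) p \<longleftrightarrow> (if p = (1, 0) then False else height_is h (happy_step p))"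

text \<open>The condition at \<open>k = 0\<close> is the test against \<open>(1, 0)\<close>; the
  later iterates of \<open>p\<close> are the iterates of \<open>happy_step p\<close>.\<close>

lemma height_is_iff:
  "height_is h p \<longleftrightarrow> (S10 ^^ h) (of_pair p) = 1 \<and> (\<forall>k<h. (S10 ^^ k) (of_pair p) \<noteq> 1)"
proof (induction h arbitrary: p)
  case 0
  show ?case by (simp flip: of_pair_one)
next
  case (Suc h)
  have "(\<forall>k<Suc h. (S10 ^^ k) (of_pair p) \<noteq> 1) \<longleftrightarrow>
      p \<noteq> (1, 0) \<and> (\<forall>k<h. (S10 ^^ k) (of_pair (happy_step p)) \<noteq> 1)"
    by (simp add: All_less_Suc2 funpow_Suc_right S10_of_pair del: funpow.simps(2))
      (simp flip: of_pair_one)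
  then show ?case
    by (auto simp: Suc.IH funpow_Suc_right S10_of_pair simp del: funpow.simps(2))
qed

lemma happy_of_height_iff:
  "gaussian_happy (of_pair p) \<and> happy_height (of_pair p) = h \<longleftrightarrow> height_is h p"
proof
  assume l: "gaussian_happy (of_pair p) \<and> happy_height (of_pair p) = h"
  then obtain k where "(S10 ^^ k) (of_pair p) = 1" by (auto simp: gaussian_happy_def)
  then have "(S10 ^^ h) (of_pair p) = 1"
    using l unfolding happy_height_def by (metis (mono_tags, lifting) LeastI)
  moreover have "(S10 ^^ k) (of_pair p) \<noteq> 1" if "k < h" for k
    using l that not_less_Least unfolding happy_height_def by blast
  ultimately show "height_is h p" by (simp add: height_is_iff)
next
  assume "height_is h p"
  then have h: "(S10 ^^ h) (of_pair p) = 1" "\<forall>k<h. (S10 ^^ k) (of_pair p) \<noteq> 1"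
    by (simp_all add: height_is_iff)
  \<comment> \<open>Happiness asks for a positive exponent, but \<open>h\<close> may be 0. Since 1
    is a fixed point, the exponent \<open>Suc h\<close> serves.\<close>
  have "happy_step (1, 0) = (1, 0)" by code_simp
  then have "S10 1 = 1" using S10_of_pair[of "(1, 0)"] by (simp add: of_pair_one)
  then have "(S10 ^^ Suc h) (of_pair p) = 1" using h(1) by simp
  then have "gaussian_happy (of_pair p)"
    unfolding gaussian_happy_def using range_of_pair by (metis le_add1 plus_1_eq_Suc rangeI)
  moreover have "happy_height (of_pair p) = h"
    unfolding happy_height_def by (rule Least_equality) (use h not_less in blast)+
  ultimately show "gaussian_happy (of_pair p) \<and> happy_height (of_pair p) = h" by blast
qed

section \<open>Minimality reduced to a finite box of lattice points\<close>

lemma cmod_of_pair_le_iff: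
  "cmod (of_pair (x, y)) \<le> cmod (of_pair (u, v)) \<longleftrightarrow> x * x + y * y \<le> u * u + v * v"
proof -
  have "cmod (of_pair (x, y)) \<le> cmod (of_pair (u, v)) \<longleftrightarrow>
      real_of_int (x * x + y * y) \<le> real_of_int (u * u + v * v)"
    by (simp add: of_pair_def cmod_def power2_eq_square)
  then show ?thesis by linarith
qed

definition smallest_in_box :: "nat \<Rightarrow> int \<Rightarrow> int \<Rightarrow> (int \<times> int) list \<Rightarrow> bool" where
  "smallest_in_box h r N ps \<longleftrightarrow> N < (r + 1) * (r + 1) \<and> 0 \<le> r \<and> ps \<noteq> [] \<and>
     list_all (\<lambda>(x, y). x * x + y * y = N \<and> height_is h (x, y)) ps \<and>
     list_all (\<lambda>x. list_all (\<lambda>y.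
       if x * x + y * y \<le> N then (if height_is h (x, y) then (x, y) \<in> set ps else True) else True)
       [-r..r]) [-r..r]"

lemma abs_le_if_square_less:
  fixes x r :: int
  assumes "x * x < (r + 1) * (r + 1)" "0 \<le> r"
  shows "x \<in> {-r..r}"
proof -
  have "\<bar>x\<bar> < \<bar>r + 1\<bar>"
    using assms(1) by (simp flip: power2_eq_square abs_le_square_iff not_le)
  with assms(2) show ?thesis by auto
qed

text \<open>As \<open>N < (r + 1)\<twosuperior>\<close>, the disc of squared radius \<open>N\<close>
  lies in the searched box. Hence no point of height \<open>h\<close> has squared norm below
  \<open>N\<close>, and those attaining \<open>N\<close> are exactly the ones listed.\<close>

lemma smallest_happy_eqI:
  assumes "smallest_in_box h r N ps"
  shows "smallest_happy h = of_pair ` set ps"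
proof -
  have N: "N < (r + 1) * (r + 1)" "0 \<le> r"
    and ps: "\<And>x y. (x, y) \<in> set ps \<Longrightarrow> x * x + y * y = N \<and> height_is h (x, y)"
    and box: "\<And>x y. x \<in> {-r..r} \<Longrightarrow> y \<in> {-r..r} \<Longrightarrow> x * x + y * y \<le> N \<Longrightarrow> height_is h (x, y)
      \<Longrightarrow> (x, y) \<in> set ps"
    using assms unfolding smallest_in_box_def list_all_iff set_upto by (fastforce split: if_splits)+
  obtain x0 y0 where p0: "(x0, y0) \<in> set ps"
    using assms unfolding smallest_in_box_def by (metis list.set_intros(1) neq_Nil_conv surj_pair)
  have small: "(x, y) \<in> set ps" if "height_is h (x, y)" "x * x + y * y \<le> N" for x y
  proof (rule box[OF _ _ that(2,1)])
    have "x * x \<ge> 0" "y * y \<ge> 0" by simp_all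
    then have "x * x < (r + 1) * (r + 1)" "y * y < (r + 1) * (r + 1)" using that(2) N by linarith+
    then show "x \<in> {-r..r}" "y \<in> {-r..r}" using N(2) by (blast intro: abs_le_if_square_less)+
  qed
  have mem: "of_pair (x, y) \<in> smallest_happy h \<longleftrightarrow>
      height_is h (x, y) \<and> (\<forall>u v. height_is h (u, v) \<longrightarrow> x * x + y * y \<le> u * u + v * v)" for x y
  proof -
    have "w \<in> range of_pair" if "gaussian_happy w" for w
      using that unfolding range_of_pair gaussian_happy_def by blast
    then have "(\<forall>w. gaussian_happy w \<and> happy_height w = h \<longrightarrow> cmod (of_pair (x, y)) \<le> cmod w) \<longleftrightarrow>
      (\<forall>p. gaussian_happy (of_pair p) \<and> happy_height (of_pair p) = h \<longrightarrow>
        cmod (of_pair (x, y)) \<le> cmod (of_pair p))"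
      by blast
    then show ?thesis
      unfolding smallest_happy_def mem_Collect_eq happy_of_height_iff
      using happy_of_height_iff[of "(x, y)" h] by (auto simp: cmod_of_pair_le_iff)
  qed
  have "of_pair (x, y) \<in> smallest_happy h \<longleftrightarrow> (x, y) \<in> set ps" for x y
  proof
    assume "of_pair (x, y) \<in> smallest_happy h"
    \<comment> \<open>The listed point \<open>(x0, y0)\<close> has squared norm \<open>N\<close>, so
      a minimiser cannot exceed \<open>N\<close> and falls within the search.\<close>
    with ps[OF p0] show "(x, y) \<in> set ps" unfolding mem by (metis small)
  next
    assume xy: "(x, y) \<in> set ps"
    have "x * x + y * y \<le> u * u + v * v" if "height_is h (u, v)" for u v
      using small[OF that] ps[OF xy] ps[of u v] by linarith
    with ps[OF xy] show "of_pair (x, y) \<in> smallest_happy h" unfolding mem by blast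
  qed
  moreover have "smallest_happy h \<subseteq> range of_pair"
    unfolding range_of_pair smallest_happy_def gaussian_happy_def by blast
  ultimately show ?thesis by (auto simp: image_iff subset_iff)
qed

section \<open>Evaluation for the seven heights\<close>

text \<open>
  The point lists below follow the order of \<^const>\<open>symmetric_images\<close>, repetitions included,
  so that \<open>simp\<close> matches the two sets element by element.
\<close>

theorem theorem10:
  shows "smallest_happy 0 = {1} \<and>
         smallest_happy 1 = {-1} \<and>
         smallest_happy 2 = {\<i>, - \<i>} \<and>
         smallest_happy 3 = symmetric_images (12 + 12 * \<i>) \<and>
         smallest_happy 4 = symmetric_images (4 + 4 * \<i>) \<and>
         smallest_happy 5 = symmetric_images 7 \<and>
         smallest_happy 6 = symmetric_images (5 + 19 * \<i>)"
proof (intro conjI)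
  \<comment> \<open>In each call, \<open>N\<close> is the squared norm of the claimed minimisers and
    \<open>r\<close> is the integer part of its square root.\<close>
  have "smallest_in_box 0 1 1 [(1, 0)]" by code_simp
  from smallest_happy_eqI[OF this] show "smallest_happy 0 = {1}"
    by (simp add: of_pair_one)
next
  have "smallest_in_box 1 1 1 [(-1, 0)]" by code_simp
  from smallest_happy_eqI[OF this] show "smallest_happy 1 = {-1}"
    by (simp add: of_pair_def Complex_eq)
next
  have "smallest_in_box 2 1 1 [(0, 1), (0, -1)]" by code_simp
  from smallest_happy_eqI[OF this] show "smallest_happy 2 = {\<i>, - \<i>}"
    by (simp add: of_pair_def Complex_eq)
next
  have "smallest_in_box 3 16 288
    [(12, 12), (-12, -12), (12, -12), (-12, 12), (-12, 12), (12, -12), (12, 12), (-12, -12)]"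
    by code_simp
  from smallest_happy_eqI[OF this] show "smallest_happy 3 = symmetric_images (12 + 12 * \<i>)"
    by (simp add: symmetric_images_def of_pair_def Complex_eq algebra_simps)
next
  have "smallest_in_box 4 5 32
    [(4, 4), (-4, -4), (4, -4), (-4, 4), (-4, 4), (4, -4), (4, 4), (-4, -4)]" by code_simp
  from smallest_happy_eqI[OF this] show "smallest_happy 4 = symmetric_images (4 + 4 * \<i>)"
    by (simp add: symmetric_images_def of_pair_def Complex_eq algebra_simps)
next
  have "smallest_in_box 5 7 49
    [(7, 0), (-7, 0), (7, 0), (-7, 0), (0, 7), (0, -7), (0, 7), (0, -7)]" by code_simp
  from smallest_happy_eqI[OF this] show "smallest_happy 5 = symmetric_images 7"
    by (simp add: symmetric_images_def of_pair_def Complex_eq algebra_simps)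
next
  have "smallest_in_box 6 19 386
    [(5, 19), (-5, -19), (5, -19), (-5, 19), (-19, 5), (19, -5), (19, 5), (-19, -5)]"
    by code_simp
  from smallest_happy_eqI[OF this] show "smallest_happy 6 = symmetric_images (5 + 19 * \<i>)"
    by (simp add: symmetric_images_def of_pair_def Complex_eq algebra_simps)
qed

end
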